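(* Let $n\geq 1$ be an integer and let $p\in\mathcal{H}[1,n]$ with $p\not\equiv 1$. Let $\Omega\subset\mathbb{C}$ and let $\psi:D\to\mathbb{C}$ be a function with domain $D\subset\mathbb{C}^3\times\mathbb{D}$ such that $\psi(r,s,t;z)\notin\Omega$ whenever $z\in\mathbb{D}$, $(r,s,t;z)\in D$ and $$r=\sqrt{2\cos 2\theta}\,e^{i\theta},\qquad s=\frac{m e^{3i\theta}}{2\sqrt{2\cos 2\theta}},\qquad \operatorname{Re}\left(\frac{t}{s}+1\right)\geq\frac{3m}{4},$$ for some real $m\geq n$ and some $\theta\in(-\pi/4,\pi/4)$. If for all $z\in\mathbb{D}$ we have $(p(z),zp'(z),z^2p''(z);z)\in D$ and $\psi(p(z),zp'(z),z^2p''(z);z)\in\Omega$, then $p(z)\prec\sqrt{1+z}$.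
   Context: $\mathbb{D}=\{z\in\mathbb{C}:|z|<1\}$. $\mathcal{H}[a,n]$ is the set of analytic functions on $\mathbb{D}$ with Taylor expansion $a+a_nz^n+a_{n+1}z^{n+1}+\cdots$. For analytic $f,g$ on $\mathbb{D}$, $f\prec g$ ($f$ is subordinate to $g$) means there is an analytic $w:\mathbb{D}\to\mathbb{D}$ with $w(0)=0$ and $f(z)=g(w(z))$ for all $z\in\mathbb{D}$. $\sqrt{1+z}$ is the principal branch (value $1$ at $z=0$); it maps $\mathbb{D}$ univalently onto $\{w:|w^2-1|<1,\ \operatorname{Re}w>0\}$. *)

theory Defs
  imports "HOL-Complex_Analysis.Complex_Analysis"
begin

definition \<H> :: "complex \<Rightarrow> nat \<Rightarrow> (complex \<Rightarrow> complex) set" where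
  "\<H> a n = {f. f holomorphic_on ball 0 1 \<and>
     (\<exists>c :: nat \<Rightarrow> complex. c 0 = a \<and> (\<forall>k. 0 < k \<and> k < n \<longrightarrow> c k = 0) \<and>
        (\<forall>z\<in>ball 0 1. (\<lambda>k. c k * z ^ k) sums f z))}"

text \<open>Functions on the unit disc are total functions here; only their values on the disc matter
  below. Subordination is a relation between analytic functions only, so analyticity of both sides
  is part of the definition.\<close>

definition subordinate :: "(complex \<Rightarrow> complex) \<Rightarrow> (complex \<Rightarrow> complex) \<Rightarrow> bool"
    (infix "\<prec>\<prec>" 50) where
  "f \<prec>\<prec> g \<longleftrightarrow> f holomorphic_on ball 0 1 \<and> g holomorphic_on ball 0 1 \<and>
     (\<exists>w. w holomorphic_on ball 0 1 \<and> w ` ball 0 1 \<subseteq> ball 0 1 \<and> w 0 = 0 \<and>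
        (\<forall>z\<in>ball 0 1. f z = g (w z)))"

end

theory Submission
  imports Defs
begin

text \<open>Since \<open>\<surd>(1 + z)\<close> inverts \<open>u \<mapsto> u\<^sup>2 - 1\<close> on the right half-plane, \<open>p \<prec>\<prec> \<surd>(1 + z)\<close> amounts to
  \<open>w = p\<^sup>2 - 1\<close> mapping the disc into itself. If it does not, take a point \<open>z\<close> of least modulus with
  \<open>|w z| = 1\<close>. Jack's lemma gives \<open>z w' = m w\<close> and \<open>Re (1 + z w''/w') \<ge> m\<close> for some \<open>m \<ge> n\<close>.
  In particular \<open>w' = 2 p p' \<noteq> 0\<close>, which keeps \<open>p z\<close> away from the corner \<open>0\<close> of the lemniscate.
  Rewriting the two relations in terms of \<open>p\<close> gives exactly the configuration excluded by
  the hypothesis on \<open>\<psi>\<close>, because \<open>Re (z p'/p) = m/4\<close> when \<open>|w| = 1\<close>.\<close>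

section \<open>Jack's lemma, with its second-order inequality\<close>

lemma second_derivative_nonpos_at_max:
  fixes h :: "real \<Rightarrow> real"
  assumes h: "\<And>x. (h has_real_derivative h' x) (at x)"
    and h': "(h' has_real_derivative c) (at a)"
    and max: "\<And>x. h x \<le> h a"
  shows "h' a = 0" "c \<le> 0"
proof -
  show crit: "h' a = 0"
    using DERIV_local_max[OF h, of 1 a] max by simp
  show "c \<le> 0"
  proof (rule ccontr)
    assume "\<not> c \<le> 0"
    \<comment> \<open>With \<open>h' a = 0\<close>, a positive \<open>c\<close> makes
      \<open>h'\<close> positive just to the right of \<open>a\<close>, so \<open>h\<close> would
      climb above its maximum.\<close>
    then obtain d where d: "d > 0" "\<And>k. 0 < k \<Longrightarrow> k < d \<Longrightarrow> h' a < h' (a + k)"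
      using DERIV_pos_inc_right[OF h'] by auto
    have "h a < h (a + d / 2)"
    proof (rule DERIV_pos_imp_increasing_open[of a "a + d / 2" h])
      show "\<exists>y. (h has_real_derivative y) (at x) \<and> 0 < y" if "a < x" "x < a + d / 2" for x
        using h[of x] d(2)[of "x - a"] that d(1) crit by (intro exI[of _ "h' x"]) auto
      show "continuous_on {a..a + d / 2} h"
        by (meson DERIV_isCont h continuous_at_imp_continuous_on)
    qed (use d in auto)
    with max[of "a + d / 2"] show False by simp
  qed
qed

text \<open>Maximum principle for \<open>g\<close>, the quotient of \<open>w\<close> by
  \<open>z^n\<close>, on the disc of radius \<open>norm z0\<close>, as in the Schwarz lemma: on the
  bounding circle the modulus of \<open>z^n\<close> is constant, so the bound on \<open>w\<close>
  becomes one on \<open>g\<close>. The factor \<open>t ^ n\<close> is what later forces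
  \<open>m \<ge> n\<close>.\<close>

lemma jack_radial_bound:
  assumes g: "g holomorphic_on ball 0 R"
    and w: "\<And>z. z \<in> ball 0 R \<Longrightarrow> w z = z ^ n * g z"
    and z0: "z0 \<in> ball 0 R" "z0 \<noteq> 0"
    and max: "\<And>z. norm z \<le> norm z0 \<Longrightarrow> norm (w z) \<le> norm (w z0)"
    and t: "0 \<le> t" "t \<le> 1"
  shows "norm (w (of_real t * z0)) \<le> t ^ n * norm (w (z0::complex))"
proof -
  have sub: "cball 0 (norm z0) \<subseteq> ball (0::complex) R"
    using z0 by auto
  have "norm (g (of_real t * z0)) \<le> norm (w z0) / norm z0 ^ n"
  proof (rule maximum_modulus_frontier[of g "cball 0 (norm z0)"])
    show "g holomorphic_on interior (cball 0 (norm z0))"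
      by (meson g sub holomorphic_on_subset interior_subset)
    show "continuous_on (closure (cball 0 (norm z0))) g"
      using continuous_on_subset[OF holomorphic_on_imp_continuous_on[OF g] sub] by simp
    show "of_real t * z0 \<in> cball 0 (norm z0)"
      using t by (auto simp: norm_mult mult_left_le_one_le)
    show "norm (g z) \<le> norm (w z0) / norm z0 ^ n" if "z \<in> frontier (cball 0 (norm z0))" for z
    proof -
      have nz: "norm z = norm z0"
        using that z0 by (simp add: frontier_cball)
      then have "norm z0 ^ n * norm (g z) \<le> norm (w z0)"
        using max[of z] w[of z] z0 by (simp add: norm_mult norm_power)
      then show ?thesis
        using z0 by (simp add: field_simps)
    qed
  qed simp
  moreover have "of_real t * z0 \<in> ball 0 R"
    using z0(1) t by (auto simp: norm_mult intro: le_less_trans[OF mult_left_le_one_le])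
  ultimately show ?thesis
    using z0 t mult_left_mono[of "norm (g (of_real t * z0))" "norm (w z0) / norm z0 ^ n" "(t * norm z0) ^ n"]
    by (simp add: w norm_mult norm_power power_mult_distrib field_simps)
qed

text \<open>The squared modulus of \<open>w\<close> is maximal at \<open>z0\<close> along the circle
  through \<open>z0\<close>. The first-order condition there makes
  \<open>z0 * deriv w z0 / w z0\<close> real, the second-order one bounds the second derivative, and
  comparison along the radius gives \<open>m \<ge> n\<close>.\<close>

lemma jack:
  assumes n: "n \<ge> 1"
    and g: "g holomorphic_on ball 0 R"
    and w: "\<And>z. z \<in> ball 0 R \<Longrightarrow> w z = z ^ n * g z"
    and z0: "z0 \<in> ball 0 R" "w z0 \<noteq> 0"
    and max: "\<And>z. norm z \<le> norm z0 \<Longrightarrow> norm (w z) \<le> norm (w z0)"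
  obtains m :: real where "m \<ge> n" "z0 * deriv w z0 = of_real m * w z0"
    "Re (1 + z0 * deriv (deriv w) z0 / deriv w z0) \<ge> m"
proof -
  have nz: "z0 \<noteq> 0"
    using z0 w[OF z0(1)] n by (auto simp: power_0_left)
  have hol: "w holomorphic_on ball 0 R"
    by (rule holomorphic_transform[of "\<lambda>z. z ^ n * g z"]) (auto intro!: holomorphic_intros g simp: w)
  then have hol': "deriv w holomorphic_on ball 0 R"
    by (rule holomorphic_deriv) simp
  have dw: "(w has_field_derivative deriv w z) (at z)"
    and dw': "(deriv w has_field_derivative deriv (deriv w) z) (at z)"
    if "z \<in> ball 0 R" for z
    using that hol hol' holomorphic_derivI[OF _ open_ball] by blast+
  define A where "A = z0 * deriv w z0"
  define B where "B = z0\<^sup>2 * deriv (deriv w) z0"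
  \<comment> \<open>Rotation along the circle: as \<open>c' = \<i> c\<close>, the first and second
    derivatives of \<open>w\<close> along \<open>c\<close> at angle 0 are \<open>\<i> * A\<close>
    and \<open>- (A + B)\<close>.\<close>
  define c where "c = (\<lambda>x::real. z0 * cis x)"
  have c_ball: "c x \<in> ball 0 R" for x
    using z0 by (simp add: c_def norm_mult)
  have dc: "(c has_vector_derivative \<i> * c x) (at x)" for x
    unfolding c_def cis_conv_exp
    by (rule has_vector_derivative_real_field derivative_eq_intros refl | simp)+
  define G where "G = (\<lambda>x. w (c x))"
  define G1 where "G1 = (\<lambda>x. \<i> * c x * deriv w (c x))"
  have dG: "(G has_vector_derivative G1 x) (at x)" for x
    using field_vector_diff_chain_at[OF dc dw[OF c_ball]] by (simp add: G_def G1_def o_def)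
  have dG1: "(G1 has_vector_derivative - (A + B)) (at 0)"
  proof -
    have "((\<lambda>x. deriv w (c x)) has_vector_derivative \<i> * c 0 * deriv (deriv w) (c 0)) (at 0)"
      using field_vector_diff_chain_at[OF dc dw'[OF c_ball]] by (simp add: o_def)
    from has_vector_derivative_mult[OF has_vector_derivative_mult_right[OF dc, of \<i>] this]
    show ?thesis
      by (simp add: G1_def c_def A_def B_def power2_eq_square algebra_simps)
  qed
  have bil: "((\<lambda>x. F x \<bullet> H x) has_real_derivative F x \<bullet> H' + F' \<bullet> H x) (at x)"
    if "(F has_vector_derivative F') (at x)" "(H has_vector_derivative H') (at x)"
    for F H :: "real \<Rightarrow> complex" and F' H' x
    using bounded_bilinear.has_vector_derivative[OF bounded_bilinear_inner that]
    by (simp add: has_real_derivative_iff_has_vector_derivative)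
  have inner_mult_ii: "(\<i> * u) \<bullet> (\<i> * v) = u \<bullet> v" for u v
    by (simp add: inner_complex_def)
  have dh: "((\<lambda>x. G x \<bullet> G x) has_real_derivative 2 * (G x \<bullet> G1 x)) (at x)" for x
    using bil[OF dG dG, of x] by (simp add: inner_commute)
  have dh': "((\<lambda>x. 2 * (G x \<bullet> G1 x)) has_real_derivative 2 * (w z0 \<bullet> - (A + B) + A \<bullet> A)) (at 0)"
    using DERIV_cmult[OF bil[OF dG dG1], of 2]
    by (simp add: G_def G1_def A_def c_def mult.assoc inner_mult_ii)
  have hmax: "G x \<bullet> G x \<le> G 0 \<bullet> G 0" for x
    using max[of "c x"] by (simp add: G_def c_def norm_mult norm_le)
  \<comment> \<open>These are half the first and second derivatives of
    \<open>G x \<bullet> G x\<close> at 0. Orthogonality of \<open>w z0\<close> and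
    \<open>\<i> * A\<close> means that \<open>A\<close> is a real multiple of
    \<open>w z0\<close>.\<close>
  have "w z0 \<bullet> (\<i> * A) = 0" and second: "w z0 \<bullet> - (A + B) + A \<bullet> A \<le> 0"
    using second_derivative_nonpos_at_max[OF dh dh' hmax]
    by (simp_all add: G_def G1_def c_def A_def mult.assoc)
  then have real: "Im (A / w z0) = 0"
    by (simp add: inner_complex_def Im_divide field_simps)
  define m where "m = Re (A / w z0)"
  have A: "A = of_real m * w z0"
    using real z0 by (simp add: m_def complex_is_Real_iff)
  \<comment> \<open>If \<open>m < n\<close>, the difference of the squares of
    \<open>norm (F t)\<close> and \<open>t ^ n * N\<close> vanishes at 1 with negative derivative,
    so it is positive just left of 1, against the radial bound.\<close>
  have "m \<ge> n"
  proof (rule ccontr)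
    assume less: "\<not> m \<ge> n"
    define N where "N = norm (w z0)"
    define F where "F = (\<lambda>t::real. w (of_real t * z0))"
    have "((\<lambda>t::real. of_real t * z0) has_vector_derivative z0) (at 1)"
      by (rule derivative_eq_intros refl | simp)+
    from field_vector_diff_chain_at[OF this, of w "deriv w z0"]
    have dF: "(F has_vector_derivative A) (at 1)"
      using dw[OF z0(1)] by (simp add: F_def A_def o_def)
    have "((\<lambda>t. F t \<bullet> F t - (t ^ n * N)\<^sup>2) has_real_derivative 2 * (F 1 \<bullet> A) - 2 * n * N\<^sup>2) (at 1)"
      by (rule derivative_eq_intros bil[OF dF dF] refl | simp)+
        (simp add: inner_commute power2_eq_square algebra_simps)
    moreover have "F 1 \<bullet> A = m * N\<^sup>2"
      unfolding N_def dot_square_norm[symmetric] by (simp add: F_def A inner_complex_def algebra_simps)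
    moreover have "2 * (m - n) * N\<^sup>2 < 0"
      using less z0(2) by (simp add: N_def mult_less_0_iff)
    ultimately have "((\<lambda>t. F t \<bullet> F t - (t ^ n * N)\<^sup>2) has_real_derivative 2 * (m - n) * N\<^sup>2) (at 1)"
      and "2 * (m - n) * N\<^sup>2 < 0"
      by (simp_all add: algebra_simps)
    then obtain d where d: "d > 0"
      "\<And>h. 0 < h \<Longrightarrow> h < d \<Longrightarrow> F 1 \<bullet> F 1 - (1 ^ n * N)\<^sup>2 < F (1 - h) \<bullet> F (1 - h) - ((1 - h) ^ n * N)\<^sup>2"
      using DERIV_neg_dec_left by (metis (no_types, lifting))
    define t where "t = 1 - min (d / 2) 1"
    have t: "0 \<le> t" "t \<le> 1"
      using d(1) by (auto simp: t_def)
    have "norm (F t) \<le> t ^ n * N"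
      unfolding F_def N_def by (rule jack_radial_bound[OF g w z0(1) nz max t])
    then have "F t \<bullet> F t \<le> (t ^ n * N)\<^sup>2"
      by (simp add: dot_square_norm power_mono)
    moreover have "F 1 \<bullet> F 1 - (1 ^ n * N)\<^sup>2 = 0"
      by (simp add: F_def N_def dot_square_norm)
    moreover have "0 < 1 - t" "1 - t < d"
      using d(1) by (auto simp: t_def)
    ultimately show False
      using d(2)[of "1 - t"] by simp
  qed
  moreover have "Re (1 + z0 * deriv (deriv w) z0 / deriv w z0) \<ge> m"
  proof -
    have m: "m > 0"
      using \<open>m \<ge> n\<close> n by linarith
    have A0: "A \<noteq> 0"
      using A m z0 by simp
    \<comment> \<open>Since \<open>A = m w\<close> with \<open>m > 0\<close>, scaling
      \<open>second\<close> by \<open>m\<close> turns \<open>w z0\<close> into \<open>A\<close>;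
      dividing by \<open>A \<bullet> A\<close> then yields the real part of
      \<open>(A + B) / A\<close>.\<close>
    have "A \<bullet> (A + B) = m * (w z0 \<bullet> (A + B))"
      by (subst A) (simp add: inner_complex_def algebra_simps)
    also have "\<dots> \<ge> m * (A \<bullet> A)"
      using second m by (intro mult_left_mono) (auto simp: inner_diff_right inner_add_right)
    finally have "m \<le> (A \<bullet> (A + B)) / (A \<bullet> A)"
      using A0 by (simp add: field_simps)
    also have "\<dots> = Re ((A + B) / A)"
      by (simp add: inner_complex_def Re_divide power2_eq_square mult.commute)
    also have "(A + B) / A = 1 + z0 * deriv (deriv w) z0 / deriv w z0"
      using A0 by (simp add: A_def B_def power2_eq_square field_simps)
    finally show ?thesis .
  qed
  ultimately show ?thesis
    using that A unfolding A_def by blast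
qed

section \<open>First point of modulus one, and splitting off \<open>z^n\<close> in
  \<open>\<H> a n\<close>\<close>

lemma first_unimodular_point:
  fixes w :: "complex \<Rightarrow> complex"
  assumes cont: "continuous_on (ball 0 R) w" and w0: "norm (w 0) < 1"
    and z1: "z1 \<in> ball 0 R" "norm (w z1) \<ge> 1"
  obtains z0 where "z0 \<in> ball 0 R" "norm (w z0) = 1"
    "\<And>z. norm z < norm z0 \<Longrightarrow> norm (w z) < 1"
    "\<And>z. norm z \<le> norm z0 \<Longrightarrow> norm (w z) \<le> 1"
proof -
  define K where "K = cball 0 (norm z1) \<inter> (\<lambda>z. norm (w z)) -` {1..}"
  have c1: "continuous_on (cball 0 r) (\<lambda>z. norm (w z))" if "r < R" for r
    by (intro continuous_on_norm continuous_on_subset[OF cont]) (use that in auto)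
  have "closed K"
    unfolding K_def using z1 by (intro continuous_closed_preimage c1) auto
  then have "compact K"
    using compact_Int_closed[OF compact_cball, of K 0 "norm z1"] by (simp add: K_def Int_assoc[symmetric])
  moreover have "z1 \<in> K"
    using z1 by (simp add: K_def)
  ultimately obtain z0 where z0: "z0 \<in> K" "\<And>z. z \<in> K \<Longrightarrow> norm z0 \<le> norm z"
    using continuous_attains_inf[of K norm] continuous_on_norm_id by (metis empty_iff)
  have inside: "z0 \<in> ball 0 R"
    using z0(1) z1(1) by (auto simp: K_def)
  have lt: "norm (w z) < 1" if "norm z < norm z0" for z
    using that z0(2)[of z] z0(1) by (force simp: K_def)
  have ne: "z0 \<noteq> 0"
    using z0 w0 by (auto simp: K_def)
  \<comment> \<open>The strict bound passes to the boundary by continuity. The closure of the open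
    disc is the closed one only for positive radius, hence \<open>ne\<close>.\<close>
  have le: "norm (w z) \<le> 1" if "norm z \<le> norm z0" for z
  proof (rule continuous_le_on_closure[of "ball 0 (norm z0)" "\<lambda>z. norm (w z)"])
    show "continuous_on (closure (ball 0 (norm z0))) (\<lambda>z. norm (w z))"
      using c1[of "norm z0"] inside ne by simp
  qed (use that lt ne in \<open>auto intro: less_imp_le\<close>)
  have "norm (w z0) = 1"
    using le[of z0] z0(1) by (simp add: K_def)
  with that inside lt le show ?thesis by blast
qed

text \<open>Shifting the coefficients by \<open>n\<close> keeps the series convergent on the disc,
  and \<open>q\<close> is its sum. For \<open>n > 0\<close> the terms split off include index 0, so
  they add up to \<open>a\<close>.\<close>

lemma \<H>_factor:
  assumes "p \<in> \<H> a n"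
  obtains q where "q holomorphic_on ball 0 1" "\<And>z. n > 0 \<Longrightarrow> z \<in> ball 0 1 \<Longrightarrow> p z = a + z ^ n * q z"
proof -
  obtain c where c: "c 0 = a" "\<And>k. 0 < k \<Longrightarrow> k < n \<Longrightarrow> c k = 0"
    "\<And>z. z \<in> ball 0 1 \<Longrightarrow> (\<lambda>k. c k * z ^ k) sums p z"
    using assms unfolding \<H>_def by blast
  define q where "q = (\<lambda>z. \<Sum>k. c (k + n) * z ^ k)"
  have shift: "(\<lambda>k. c (k + n) * z ^ k) sums q z" if "z \<in> ball 0 1" for z
  proof -
    have "summable (\<lambda>k. c (k + n) * z ^ k)"
      using summable_powser_ignore_initial_segment[of c n z] c(3)[OF that] by (simp add: sums_iff)
    then show ?thesis by (simp add: q_def summable_sums)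
  qed
  have "q holomorphic_on ball 0 1"
    using power_series_holomorphic[of 0 1 "\<lambda>k. c (k + n)" q] shift by simp
  moreover have "p z = a + z ^ n * q z" if n: "n > 0" and z: "z \<in> ball 0 1" for z
  proof -
    have "(\<Sum>k<n. c k * z ^ k) = (\<Sum>k\<in>{0}. c k * z ^ k)"
      by (rule sum.mono_neutral_right) (use n c in auto)
    then have "(\<lambda>k. c (k + n) * z ^ (k + n)) sums (p z - a)"
      using sums_split_initial_segment[OF c(3)[OF z], of n] c(1) by simp
    moreover have "(\<lambda>k. c (k + n) * z ^ (k + n)) sums (z ^ n * q z)"
      using sums_mult[OF shift[OF z], of "z ^ n"] by (simp add: power_add algebra_simps)
    ultimately show ?thesis
      using sums_unique2 by (metis add_diff_cancel_left' diff_add_cancel)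
  qed
  ultimately show ?thesis using that by blast
qed

section \<open>Geometry of the right loop of the lemniscate\<close>

lemma Re_pos_of_lemniscate:
  assumes cont: "continuous_on S p" and conn: "connected S" and a: "a \<in> S" "Re (p a) > 0"
    and lem: "\<And>z. z \<in> S \<Longrightarrow> norm ((p z)\<^sup>2 - 1) < 1" and z: "z \<in> S"
  shows "Re (p z) > 0"
proof (rule ccontr)
  assume neg: "\<not> Re (p z) > 0"
  have "connected ((\<lambda>z. Re (p z)) ` S)"
    by (intro connected_continuous_image conn continuous_intros cont)
  \<comment> \<open>By connectedness, leaving the right half-plane means meeting the imaginary axis,
    where the square is real and at most 0, hence at distance at least 1 from 1.\<close>
  then have "0 \<in> (\<lambda>z. Re (p z)) ` S"
    using a z neg connectedD_interval[of _ "Re (p z)" "Re (p a)" 0] by auto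
  then obtain u where u: "u \<in> S" "Re (p u) = 0" by force
  have "1 \<le> \<bar>Re ((p u)\<^sup>2 - 1)\<bar>"
    using u zero_le_square[of "Im (p u)"] by (simp add: power2_eq_square del: zero_le_square)
  also have "\<dots> \<le> norm ((p u)\<^sup>2 - 1)"
    by (rule abs_Re_le_cmod)
  finally show False using lem[OF u(1)] by simp
qed

text \<open>With \<open>r = \<rho> cis \<theta>\<close>, the condition expands to
  \<open>\<rho>^2 (\<rho>^2 - 2 cos (2 \<theta>)) = 0\<close>, and \<open>\<rho> > 0\<close> leaves
  the second factor.\<close>

lemma lemniscate_polar:
  assumes "Re r > 0" and "norm (r\<^sup>2 - 1) = 1"
  obtains \<theta> where "\<theta> \<in> {- pi / 4 <..< pi / 4}"
    "r = of_real (sqrt (2 * cos (2 * \<theta>))) * exp (\<i> * of_real \<theta>)"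
    "r\<^sup>2 - 1 = exp (\<i> * of_real \<theta>) ^ 4"
proof -
  define \<theta> where "\<theta> = Arg r"
  define \<rho> where "\<rho> = norm r"
  have r: "r \<noteq> 0" "r = of_real \<rho> * cis \<theta>" "\<rho> > 0"
    using assms rcis_cmod_Arg[of r] by (auto simp: \<theta>_def \<rho>_def rcis_def)
  have r2: "r\<^sup>2 = of_real (\<rho>\<^sup>2) * cis (2 * \<theta>)"
    using Complex.DeMoivre[of \<theta> 2] by (subst r(2)) (simp add: power_mult_distrib)
  have "(norm (r\<^sup>2 - 1))\<^sup>2 = (\<rho>\<^sup>2)\<^sup>2 - 2 * \<rho>\<^sup>2 * cos (2 * \<theta>) + 1"
    unfolding r2 cmod_power2
    using sin_cos_squared_add[of "2 * \<theta>"]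
    by (simp add: power2_eq_square) (algebra)
  then have "\<rho>\<^sup>2 * (\<rho>\<^sup>2 - 2 * cos (2 * \<theta>)) = 0"
    unfolding assms(2) by (simp add: power2_eq_square[of "\<rho>\<^sup>2"] right_diff_distrib)
  then have \<rho>: "\<rho>\<^sup>2 = 2 * cos (2 * \<theta>)"
    using r(3) by simp
  then have cos_pos: "cos (2 * \<theta>) > 0"
    using r(3) by (metis zero_less_power zero_less_mult_pos zero_less_numeral)
  have "\<bar>\<theta>\<bar> < pi / 2"
    using assms Arg_Re_pos[of r] by (simp add: \<theta>_def)
  \<comment> \<open>The right half-plane only gives \<open>\<bar>2 * \<theta>\<bar> < pi\<close>;
    positivity of the cosine, which decreases on \<open>{0..pi}\<close>, halves this range.\<close>
  then have range: "\<theta> \<in> {- pi / 4 <..< pi / 4}"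
    using cos_pos cos_monotone_0_pi_le[of "pi / 2" "\<bar>2 * \<theta>\<bar>"] by (cases "\<theta> \<ge> 0") (fastforce simp: field_simps)+
  have "r = of_real (sqrt (2 * cos (2 * \<theta>))) * exp (\<i> * of_real \<theta>)"
    using r \<rho> by (metis cis_conv_exp real_sqrt_unique less_imp_le)
  moreover have "r\<^sup>2 - 1 = exp (\<i> * of_real \<theta>) ^ 4"
  proof -
    \<comment> \<open>With \<open>x = 2 * \<theta>\<close> this is
      \<open>cis x + cis (- x) = 2 cos x\<close> multiplied by \<open>cis x\<close>.\<close>
    have "cis \<theta> ^ 4 = (cis (2 * \<theta>))\<^sup>2"
      by (simp add: Complex.DeMoivre)
    also have "\<dots> = 2 * of_real (cos (2 * \<theta>)) * cis (2 * \<theta>) - 1"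
      using sin_cos_squared_add[of "2 * \<theta>"] by (auto simp: complex_eq_iff power2_eq_square)
    finally show ?thesis
      by (simp add: r2 \<rho> cis_conv_exp)
  qed
  ultimately show ?thesis using that range by blast
qed

text \<open>The squared modulus of \<open>1 + w\<close> is \<open>2 (1 + Re w)\<close>, twice the
  real part of \<open>w\<close> times the conjugate of \<open>1 + w\<close>. It is applied to
  \<open>w = p^2 - 1\<close>, where \<open>1 + w = p^2\<close>.\<close>

lemma Re_divide_one_plus_unimodular:
  assumes "norm w = 1" "1 + w \<noteq> 0"
  shows "Re (w / (1 + w)) = 1 / 2"
proof -
  have w: "(Re w)\<^sup>2 + (Im w)\<^sup>2 = 1"
    using assms(1) by (metis cmod_power2 one_power2)
  have "(1 + Re w)\<^sup>2 + (Im w)\<^sup>2 = 2 * (1 + Re w)"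
    and "Re w * (1 + Re w) + Im w * Im w = 1 + Re w"
    using w by (simp_all add: power2_eq_square algebra_simps)
  moreover have "1 + Re w \<noteq> 0"
    using w assms(2) by (auto simp: complex_eq_iff add_eq_0_iff)
  ultimately show ?thesis
    by (simp add: Re_divide)
qed

section \<open>First contact of \<open>p\<close> with the lemniscate\<close>

lemma lemniscate_contact:
  assumes n: "n \<ge> 1" and p: "p \<in> \<H> 1 n"
    and z1: "z1 \<in> ball 0 1" "norm ((p z1)\<^sup>2 - 1) \<ge> 1"
  obtains z m \<theta> where "z \<in> ball 0 1" "m \<ge> real n" "\<theta> \<in> {- pi / 4 <..< pi / 4}"
    "p z = of_real (sqrt (2 * cos (2 * \<theta>))) * exp (\<i> * of_real \<theta>)"
    "z * deriv p z = of_real m * exp (3 * \<i> * of_real \<theta>) / of_real (2 * sqrt (2 * cos (2 * \<theta>)))"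
    "Re (z\<^sup>2 * deriv (deriv p) z / (z * deriv p z) + 1) \<ge> 3 * m / 4"
proof -
  define w where "w = (\<lambda>z. (p z)\<^sup>2 - 1)"
  obtain q where q: "q holomorphic_on ball 0 1" "\<And>z. z \<in> ball 0 1 \<Longrightarrow> p z = 1 + z ^ n * q z"
    using \<H>_factor[OF p] n by (metis One_nat_def Suc_le_eq)
  have hol: "p holomorphic_on ball 0 1"
    using p by (simp add: \<H>_def)
  then have hol': "deriv p holomorphic_on ball 0 1"
    by (rule holomorphic_deriv) simp
  note cont = holomorphic_on_imp_continuous_on[OF hol]
  have p0: "p 0 = 1"
    using q(2)[of 0] n by (simp add: power_0_left)
  have cw: "continuous_on (ball 0 1) w"
    unfolding w_def by (intro continuous_intros cont)
  obtain z where z: "z \<in> ball 0 1" "norm (w z) = 1"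
    "\<And>u. norm u < norm z \<Longrightarrow> norm (w u) < 1" "\<And>u. norm u \<le> norm z \<Longrightarrow> norm (w u) \<le> 1"
    using first_unimodular_point[OF cw _ z1(1)] z1(2) p0 by (auto simp: w_def)
  have z_nz: "z \<noteq> 0"
    using z(2) p0 by (auto simp: w_def)
  \<comment> \<open>From \<open>p - 1 = z^n q\<close> and \<open>w = (p - 1) (p + 1)\<close> comes
    the cofactor \<open>q (2 + z^n q)\<close> needed for Jack's lemma.\<close>
  obtain m where m: "m \<ge> real n" "z * deriv w z = of_real m * w z"
    "Re (1 + z * deriv (deriv w) z / deriv w z) \<ge> m"
  proof (rule jack[of n "\<lambda>z. q z * (2 + z ^ n * q z)" 1 w z])
    show "w u = u ^ n * (q u * (2 + u ^ n * q u))" if "u \<in> ball 0 1" for u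
      using that by (simp add: w_def q(2) power2_eq_square algebra_simps)
  qed (use n z in \<open>auto intro!: holomorphic_intros q\<close>)
  have dw: "deriv w u = 2 * p u * deriv p u" if "u \<in> ball 0 1" for u
    unfolding w_def
    by (rule DERIV_imp_deriv) (rule derivative_eq_intros holomorphic_derivI[OF hol open_ball that] refl | simp)+
  have "((\<lambda>u. 2 * p u * deriv p u) has_field_derivative 2 * (deriv p z)\<^sup>2 + 2 * p z * deriv (deriv p) z) (at z)"
    using DERIV_mult[OF DERIV_cmult[OF holomorphic_derivI[OF hol open_ball z(1)], of 2]
        holomorphic_derivI[OF hol' open_ball z(1)]]
    by (simp add: power2_eq_square algebra_simps)
  then have ddw: "deriv (deriv w) z = 2 * (deriv p z)\<^sup>2 + 2 * p z * deriv (deriv p) z"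
    by (rule DERIV_imp_deriv[OF has_field_derivative_transform_within_open[OF _ open_ball z(1)]])
      (simp add: dw)
  have m_pos: "m > 0"
    using m(1) n by linarith
  then have "deriv w z \<noteq> 0"
    using m(2) z(2) by auto
  then have nz: "p z \<noteq> 0" "deriv p z \<noteq> 0"
    by (auto simp: dw[OF z(1)])
  have Re_in: "Re (p u) > 0" if "norm u < norm z" for u
  proof (rule Re_pos_of_lemniscate[of "ball 0 (norm z)" p 0])
    show "continuous_on (ball 0 (norm z)) p"
      by (rule continuous_on_subset[OF cont]) (use z in auto)
  qed (use that z z_nz p0 in \<open>auto simp: w_def\<close>)
  \<comment> \<open>At the contact point itself continuity leaves only the weak inequality. Equality
    is excluded next: on the imaginary axis the modulus of \<open>w\<close> is
    \<open>1 + (Im p)^2\<close>, so it equals 1 only for \<open>p z = 0\<close>.\<close>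
  have Re_ge: "Re (p z) \<ge> 0"
  proof (rule continuous_ge_on_closure[of "ball 0 (norm z)" "\<lambda>u. Re (p u)"])
    show "continuous_on (closure (ball 0 (norm z))) (\<lambda>u. Re (p u))"
      using z z_nz by (auto intro!: continuous_intros continuous_on_subset[OF cont])
  qed (use Re_in z_nz in \<open>auto intro: less_imp_le\<close>)
  have "Re (p z) \<noteq> 0"
  proof
    assume im: "Re (p z) = 0"
    then have "w z = of_real (- (Im (p z))\<^sup>2 - 1)"
      by (simp add: w_def complex_eq_iff power2_eq_square)
    then have "norm (w z) = (Im (p z))\<^sup>2 + 1"
      by (metis abs_minus_cancel abs_of_nonneg minus_diff_eq norm_of_real diff_minus_eq_add
          add.commute add_nonneg_nonneg zero_le_power2 zero_le_one)
    then show False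
      using z(2) im nz(1) by (simp add: complex_eq_iff)
  qed
  with Re_ge obtain \<theta> where \<theta>: "\<theta> \<in> {- pi / 4 <..< pi / 4}"
    "p z = of_real (sqrt (2 * cos (2 * \<theta>))) * exp (\<i> * of_real \<theta>)"
    "w z = exp (\<i> * of_real \<theta>) ^ 4"
    using lemniscate_polar[of "p z"] z(2) by (auto simp: w_def)
  \<comment> \<open>Solving \<open>2 z p p' = m w\<close> for \<open>z p'\<close>; dividing the
    fourth power of \<open>exp (\<i> \<theta>)\<close> in \<open>w\<close> by the single one in
    \<open>p\<close> leaves the third power.\<close>
  have s: "z * deriv p z = of_real m * w z / (2 * p z)"
    using m(2) nz(1) dw[OF z(1)] by (simp add: field_simps)
  moreover have "exp (3 * \<i> * of_real \<theta>) = exp (\<i> * of_real \<theta>) ^ 3"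
    by (simp add: exp_of_nat_mult[symmetric] mult.assoc)
  ultimately have s': "z * deriv p z = of_real m * exp (3 * \<i> * of_real \<theta>) / of_real (2 * sqrt (2 * cos (2 * \<theta>)))"
    unfolding \<theta>(2,3) by (simp add: field_simps power3_eq_cube power4_eq_xxxx)
  have half: "Re (w z / (1 + w z)) = 1 / 2"
    using Re_divide_one_plus_unimodular[OF z(2)] nz(1) by (simp add: w_def)
  have "z * deriv p z / p z = of_real (m / 2) * (w z / (1 + w z))"
    using s nz(1) by (simp add: w_def power2_eq_square)
  then have "Re (z * deriv p z / p z) = m / 2 * Re (w z / (1 + w z))"
    by (simp only: Im_complex_of_real Re_complex_of_real times_complex.sel mult_zero_left diff_zero)
  then have "Re (z * deriv p z / p z) = m / 4"
    unfolding half by simp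
  \<comment> \<open>Logarithmic derivative of \<open>w' = 2 p p'\<close>. The extra term
    \<open>z p' / p\<close> has real part \<open>m / 4\<close>, so the bound \<open>m\<close> drops
    to \<open>3 m / 4\<close>.\<close>
  moreover have "1 + z * deriv (deriv w) z / deriv w z
      = z\<^sup>2 * deriv (deriv p) z / (z * deriv p z) + 1 + z * deriv p z / p z"
    using nz z_nz by (simp add: ddw dw[OF z(1)] field_simps power2_eq_square)
  ultimately have "Re (z\<^sup>2 * deriv (deriv p) z / (z * deriv p z) + 1) \<ge> 3 * m / 4"
    using m(3) by simp
  with that z(1) m(1) \<theta>(1,2) s' show ?thesis by blast
qed

section \<open>Subordination and conclusion\<close>

lemma subordinate_csqrt:
  assumes hol: "p holomorphic_on ball 0 1" and p0: "p 0 = 1"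
    and lem: "\<And>z. z \<in> ball 0 1 \<Longrightarrow> norm ((p z)\<^sup>2 - 1) < 1"
  shows "p \<prec>\<prec> (\<lambda>z. csqrt (1 + z))"
  unfolding subordinate_def
proof (intro conjI exI[of _ "\<lambda>z. (p z)\<^sup>2 - 1"] ballI)
  show "(\<lambda>z. csqrt (1 + z)) holomorphic_on ball 0 1"
  proof (intro holomorphic_intros)
    show "1 + z \<notin> \<real>\<^sub>\<le>\<^sub>0" if "z \<in> ball 0 1" for z :: complex
      using that abs_Re_le_cmod[of z] by (auto simp: complex_nonpos_Reals_iff)
  qed
  \<comment> \<open>The principal root of the square of \<open>p z\<close> is \<open>p z\<close>
    itself because \<open>p\<close> stays in the right half-plane.\<close>
  show "p z = csqrt (1 + ((p z)\<^sup>2 - 1))" if "z \<in> ball 0 1" for z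
    using Re_pos_of_lemniscate[OF holomorphic_on_imp_continuous_on[OF hol] _ _ _ lem that, of 0] p0
    by (simp add: csqrt_square)
qed (use hol lem p0 in \<open>auto intro!: holomorphic_intros\<close>)

theorem theorem2p3:
  fixes n :: nat and p :: "complex \<Rightarrow> complex" and \<Omega> :: "complex set"
    and D :: "(complex \<times> complex \<times> complex \<times> complex) set"
    and \<psi> :: "complex \<times> complex \<times> complex \<times> complex \<Rightarrow> complex"
  assumes "n \<ge> 1"
    and "p \<in> \<H> 1 n"
    and "\<exists>z\<in>ball 0 1. p z \<noteq> 1"
    and "D \<subseteq> UNIV \<times> UNIV \<times> UNIV \<times> ball 0 1"
    and "\<And>r s t z (m::real) (\<theta>::real).
           \<lbrakk> z \<in> ball 0 1; (r, s, t, z) \<in> D; m \<ge> real n; \<theta> \<in> {- pi / 4 <..< pi / 4};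
             r = of_real (sqrt (2 * cos (2 * \<theta>))) * exp (\<i> * of_real \<theta>);
             s = of_real m * exp (3 * \<i> * of_real \<theta>) / of_real (2 * sqrt (2 * cos (2 * \<theta>)));
             Re (t / s + 1) \<ge> 3 * m / 4 \<rbrakk>
           \<Longrightarrow> \<psi> (r, s, t, z) \<notin> \<Omega>"
    and "\<And>z. z \<in> ball 0 1 \<Longrightarrow> (p z, z * deriv p z, z\<^sup>2 * deriv (deriv p) z, z) \<in> D"
    and "\<And>z. z \<in> ball 0 1 \<Longrightarrow> \<psi> (p z, z * deriv p z, z\<^sup>2 * deriv (deriv p) z, z) \<in> \<Omega>"
  shows "p \<prec>\<prec> (\<lambda>z. csqrt (1 + z))"
proof (rule subordinate_csqrt)
  show "p holomorphic_on ball 0 1"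
    using assms(2) by (simp add: \<H>_def)
  obtain q where "\<And>z. z \<in> ball 0 1 \<Longrightarrow> p z = 1 + z ^ n * q z"
    using \<H>_factor[OF assms(2)] assms(1) by (metis One_nat_def Suc_le_eq)
  then show "p 0 = 1"
    using assms(1) by (simp add: power_0_left)
  show "norm ((p z)\<^sup>2 - 1) < 1" if z: "z \<in> ball 0 1" for z
  proof (rule ccontr)
    assume "\<not> norm ((p z)\<^sup>2 - 1) < 1"
    \<comment> \<open>The contact point need not be \<open>z\<close>; there the value of
      \<open>\<psi>\<close> lies both in and outside \<open>\<Omega>\<close>.\<close>
    then show False
      using lemniscate_contact[OF assms(1,2) z] assms(5)[OF _ assms(6)] assms(7)
      by (metis linorder_not_less)
  qed
qed

end
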